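(* Let $G$ be a digraph and let $(A,B,C)$ be a $k$-triple of $G$. Then $G$ contains every semi-complete digraph with $k$ vertices as a minor.
   Context: All digraphs are finite (in general loops and parallel edges are allowed); an edge $uv$ has tail $u$ and head $v$. A digraph is simple if it is loopless and there is at most one edge $uv$ for every ordered pair of distinct vertices $u,v$ (so $uv$ and $vu$ may both be edges). A simple digraph $G$ is semi-complete if for all distinct $u,v\in V(G)$ at least one of $uv, vu$ is an edge. A digraph is strongly-connected if it is non-null and has a directed path from $u$ to $v$ for all vertices $u,v$. For mutually disjoint subsets $A,B,C$ of $V(G)$, $(A,B,C)$ is a $k$-triple if $|A|=|B|=|C|=k$; $ab\in E(G)$ for all $a\in A$, $b\in B$; $bc\in E(G)$ for all $b\in B$, $c\in C$; and $A,C$ can be numbered as $\{a_1,\ldots,a_k\}$ and $\{c_1,\ldots,c_k\}$ such that $c_ia_i\in E(G)$ for $i=1,\ldots,k$. Minors: a digraph $H$ is a minor of a digraph $G$ if $H$ can be obtained from a subdigraph of $G$ by repeatedly contracting a strongly-connected subdigraph to a vertex. Equivalently, there is a minor mapping from $H$ to $G$, i.e. a mapping $\phi$ defined on $V(H)$ such that: (i) for every $v\in V(H)$, $\phi(v)$ is a non-null strongly-connected subdigraph of $G$; (ii) $\phi(u)$ and $\phi(v)$ are vertex-disjoint for distinct $u,v\in V(H)$; (iii) for all $u,v\in V(H)$ (not necessarily distinct), if there are $n$ edges of $H$ with tail $u$ and head $v$, then there are at least $n$ edges of $G$ with tail in $V(\phi(u))$ and head in $V(\phi(v))$ that are not contained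 in $E(\phi(x))$ for any $x\in V(H)$. *)

theory Defs
  imports "Graph_Theory.Digraph_Isomorphism"
begin

text \<open>
  Finite digraphs with loops and parallel edges allowed are \<^locale>\<open>fin_digraph\<close>; simple finite
  digraphs are \<^locale>\<open>digraph\<close>. The null digraph is allowed, but is not \<^const>\<open>strongly_connected\<close>.
\<close>

definition semi_complete :: "('a, 'b) pre_digraph \<Rightarrow> bool" where
  "semi_complete G \<longleftrightarrow>
     digraph G \<and>
     (\<forall>u \<in> verts G. \<forall>v \<in> verts G. u \<noteq> v \<longrightarrow> u \<rightarrow>\<^bsub>G\<^esub> v \<or> v \<rightarrow>\<^bsub>G\<^esub> u)"

definition k_triple ::
    "('a, 'b) pre_digraph \<Rightarrow> nat \<Rightarrow> 'a set \<Rightarrow> 'a set \<Rightarrow> 'a set \<Rightarrow> bool" where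
  "k_triple G k A B C \<longleftrightarrow>
     A \<subseteq> verts G \<and> B \<subseteq> verts G \<and> C \<subseteq> verts G \<and>
     A \<inter> B = {} \<and> A \<inter> C = {} \<and> B \<inter> C = {} \<and>
     card A = k \<and> card B = k \<and> card C = k \<and>
     (\<forall>a \<in> A. \<forall>b \<in> B. a \<rightarrow>\<^bsub>G\<^esub> b) \<and>
     (\<forall>b \<in> B. \<forall>c \<in> C. b \<rightarrow>\<^bsub>G\<^esub> c) \<and>
     (\<exists>a c. bij_betw a {1..k} A \<and> bij_betw c {1..k} C \<and>
            (\<forall>i \<in> {1..k}. c i \<rightarrow>\<^bsub>G\<^esub> a i))"

text \<open>
  Contracting a subdigraph \<open>S\<close> of \<open>G\<close>: the edges of \<open>S\<close> disappear and its vertices are identified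
  to the single vertex \<open>w\<close>, which will always be one of the vertices of \<open>S\<close>, so that the vertex type
  does not change. An edge of \<open>G\<close> that is not in \<open>S\<close> but has both ends in \<open>S\<close> becomes a loop at \<open>w\<close>.
\<close>

definition contract ::
    "('a, 'b) pre_digraph \<Rightarrow> ('a, 'b) pre_digraph \<Rightarrow> 'a \<Rightarrow> ('a, 'b) pre_digraph" where
  "contract G S w =
     \<lparr> verts = insert w (verts G - verts S),
       arcs = arcs G - arcs S,
       tail = (\<lambda>e. if tail G e \<in> verts S then w else tail G e),
       head = (\<lambda>e. if head G e \<in> verts S then w else head G e) \<rparr>"

definition contraction_step :: "('a, 'b) pre_digraph \<Rightarrow> ('a, 'b) pre_digraph \<Rightarrow> bool" where
  "contraction_step G G' \<longleftrightarrow>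
     (\<exists>S w. subgraph S G \<and> strongly_connected S \<and> w \<in> verts S \<and> G' = contract G S w)"

definition minor_of :: "('c, 'd) pre_digraph \<Rightarrow> ('a, 'b) pre_digraph \<Rightarrow> bool" where
  "minor_of H G \<longleftrightarrow>
     (\<exists>G\<^sub>0 G\<^sub>1. subgraph G\<^sub>0 G \<and> contraction_step\<^sup>*\<^sup>* G\<^sub>0 G\<^sub>1 \<and> digraph_iso G\<^sub>1 H)"

end

theory Submission
  imports Defs
begin

text \<open>
  Number the three sets of the triple as \<open>a\<^sub>i\<close>, \<open>b\<^sub>i\<close>, \<open>c\<^sub>i\<close> such that every \<open>c\<^sub>i a\<^sub>i\<close> is an edge; the
  numbering of \<open>B\<close> is arbitrary. Then \<open>a\<^sub>i b\<^sub>i c\<^sub>i\<close> is a directed triangle for each \<open>i\<close>, the \<open>k\<close>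
  triangles are disjoint, and for any two of them, say the \<open>i\<close>-th and the \<open>j\<close>-th, the edge \<open>a\<^sub>i b\<^sub>j\<close>
  leads from the first to the second and lies in no triangle. Keep the triangles and those edges
  \<open>a\<^sub>i b\<^sub>j\<close> for which \<open>H\<close> has an edge from its \<open>i\<close>-th to its \<open>j\<close>-th vertex; contracting the triangles
  then produces \<open>H\<close>. One edge per ordered pair is enough because \<open>H\<close> has no parallel edges, and the
  edges \<open>a\<^sub>i b\<^sub>i\<close> are free to be used in the triangles because \<open>H\<close> has no loops.

  What remains is to pass from this minor mapping to a sequence of contractions, which is
  \<open>minor_of_if_minor_mapping\<close>. Its core is \<open>contract_disjoint_family\<close>: disjoint
  strongly connected subdigraphs can be contracted one after the other, because contracting one of
  them does not affect the ends of the edges of the others.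
\<close>

section \<open>From minor mappings to contraction sequences\<close>

text \<open>
  Being a subdigraph requires the same incidence functions on all edges, so after a contraction the
  remaining members of a family have to be re-equipped with the new incidence functions. Strong
  connectivity survives, since it depends on the incidences of their own edges only.
\<close>

lemma strongly_connected_cong_ends:
  assumes "strongly_connected S"
    and "verts S' = verts S" "arcs S' = arcs S"
    and "\<And>e. e \<in> arcs S \<Longrightarrow> tail S' e = tail S e"
    and "\<And>e. e \<in> arcs S \<Longrightarrow> head S' e = head S e"
  shows "strongly_connected S'"
proof -
  have "arcs_ends S' = arcs_ends S"
    unfolding arcs_ends_def arc_to_ends_def using assms(3-5) by (intro image_cong) auto
  then show ?thesis
    using assms(1,2) unfolding strongly_connected_def reachable_def by simp
qed

lemma wf_digraph_contract:
  assumes "wf_digraph G" "w \<in> verts S"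
  shows "wf_digraph (contract G S w)"
proof -
  interpret wf_digraph G by fact
  show ?thesis by unfold_locales (auto simp: contract_def)
qed

text \<open>
  The members are contracted one by one. By disjointness, contracting some of them changes neither
  the vertices nor the ends of the edges of another one, which therefore is still a strongly
  connected subdigraph of the current digraph. The order of the contractions does not matter, so the
  resulting incidence functions are characterized by their values rather than by an iterated
  \<^const>\<open>contract\<close>.
\<close>

lemma contract_disjoint_family:
  assumes "finite I"
    and "wf_digraph G"
    and "\<And>i. i \<in> I \<Longrightarrow> subgraph (S i) G"
    and "\<And>i. i \<in> I \<Longrightarrow> strongly_connected (S i)"
    and "\<And>i. i \<in> I \<Longrightarrow> w i \<in> verts (S i)"
    and "\<And>i j. i \<in> I \<Longrightarrow> j \<in> I \<Longrightarrow> i \<noteq> j \<Longrightarrow> verts (S i) \<inter> verts (S j) = {}"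
  shows "\<exists>G'. contraction_step\<^sup>*\<^sup>* G G' \<and> wf_digraph G' \<and>
    verts G' = w ` I \<union> (verts G - (\<Union>i\<in>I. verts (S i))) \<and>
    arcs G' = arcs G - (\<Union>i\<in>I. arcs (S i)) \<and>
    (\<forall>i\<in>I. \<forall>e. tail G e \<in> verts (S i) \<longrightarrow> tail G' e = w i) \<and>
    (\<forall>i\<in>I. \<forall>e. head G e \<in> verts (S i) \<longrightarrow> head G' e = w i) \<and>
    (\<forall>e. tail G e \<notin> (\<Union>i\<in>I. verts (S i)) \<longrightarrow> tail G' e = tail G e) \<and>
    (\<forall>e. head G e \<notin> (\<Union>i\<in>I. verts (S i)) \<longrightarrow> head G' e = head G e)"
  using assms(1,3-)
proof (induction I)
  case empty
  then show ?case using \<open>wf_digraph G\<close> by (intro exI[of _ G]) auto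
next
  case (insert j I)
  have "\<exists>G'. contraction_step\<^sup>*\<^sup>* G G' \<and> wf_digraph G' \<and>
    verts G' = w ` I \<union> (verts G - (\<Union>i\<in>I. verts (S i))) \<and>
    arcs G' = arcs G - (\<Union>i\<in>I. arcs (S i)) \<and>
    (\<forall>i\<in>I. \<forall>e. tail G e \<in> verts (S i) \<longrightarrow> tail G' e = w i) \<and>
    (\<forall>i\<in>I. \<forall>e. head G e \<in> verts (S i) \<longrightarrow> head G' e = w i) \<and>
    (\<forall>e. tail G e \<notin> (\<Union>i\<in>I. verts (S i)) \<longrightarrow> tail G' e = tail G e) \<and>
    (\<forall>e. head G e \<notin> (\<Union>i\<in>I. verts (S i)) \<longrightarrow> head G' e = head G e)"
    by (rule insert.IH) (use insert.prems in auto)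
  then obtain G' where steps: "contraction_step\<^sup>*\<^sup>* G G'" and wf: "wf_digraph G'"
    and V: "verts G' = w ` I \<union> (verts G - (\<Union>i\<in>I. verts (S i)))"
    and E: "arcs G' = arcs G - (\<Union>i\<in>I. arcs (S i))"
    and tail_in: "\<And>i e. i \<in> I \<Longrightarrow> tail G e \<in> verts (S i) \<Longrightarrow> tail G' e = w i"
    and head_in: "\<And>i e. i \<in> I \<Longrightarrow> head G e \<in> verts (S i) \<Longrightarrow> head G' e = w i"
    and tail_out: "\<And>e. tail G e \<notin> (\<Union>i\<in>I. verts (S i)) \<Longrightarrow> tail G' e = tail G e"
    and head_out: "\<And>e. head G e \<notin> (\<Union>i\<in>I. verts (S i)) \<Longrightarrow> head G' e = head G e"
    by (elim exE conjE) (rule that, assumption, simp_all)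
  have disj: "verts (S i) \<inter> verts (S j) = {}" if "i \<in> I" for i
    using that insert.hyps insert.prems(4)[of i j] by auto
  have w_notin: "w i \<notin> verts (S j)" if "i \<in> I" for i
    using that disj[OF that] insert.prems(3)[of i] by auto
  have ends: "tail G e \<in> verts (S i)" "head G e \<in> verts (S i)"
    if "i \<in> insert j I" "e \<in> arcs (S i)" for i e
    using insert.prems(1)[OF that(1)] that(2)
    by (auto simp: subgraph_def compatible_def dest: wf_digraph.wellformed)
  have ends': "tail G' e = tail G e" "head G' e = head G e" if "e \<in> arcs (S j)" for e
    using ends[OF _ that] disj by (auto intro!: tail_out head_out)
  have sub: "subgraph (S j) G" and sc: "strongly_connected (S j)" and wj: "w j \<in> verts (S j)"
    using insert.prems(1-3) by auto
  define T where "T = \<lparr>verts = verts (S j), arcs = arcs (S j), tail = tail G', head = head G'\<rparr>"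
  have T_simps [simp]: "verts T = verts (S j)" "arcs T = arcs (S j)" "tail T = tail G'"
    "head T = head G'"
    by (simp_all add: T_def)
  have "subgraph T G'"
  proof (rule subgraphI)
    show "verts T \<subseteq> verts G'"
      using sub disj by (auto simp: V subgraph_def)
    show "arcs T \<subseteq> arcs G'"
    proof
      fix e assume "e \<in> arcs T"
      then have e: "e \<in> arcs (S j)" by simp
      then have "e \<notin> arcs (S i)" if "i \<in> I" for i
        using ends(1)[of i e] ends(1)[of j e] disj[OF that] that by auto
      with e sub show "e \<in> arcs G'" by (auto simp: E subgraph_def)
    qed
    show "compatible G' T" by (simp add: compatible_def)
    show "wf_digraph T"
      by unfold_locales (use ends ends' in auto)
  qed (rule wf)
  moreover have "strongly_connected T"
    using sc by (rule strongly_connected_cong_ends)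
      (use sub ends' in \<open>auto simp: subgraph_def compatible_def\<close>)
  ultimately have "contraction_step G' (contract G' T (w j))"
    unfolding contraction_step_def using wj by force
  with steps have step: "contraction_step\<^sup>*\<^sup>* G (contract G' T (w j))"
    by (rule rtranclp.rtrancl_into_rtrancl)
  have wf': "wf_digraph (contract G' T (w j))"
    using wf wj by (intro wf_digraph_contract) auto
  have V': "verts (contract G' T (w j)) =
      w ` insert j I \<union> (verts G - (\<Union>i\<in>insert j I. verts (S i)))"
    using w_notin by (auto simp: contract_def V)
  have E': "arcs (contract G' T (w j)) = arcs G - (\<Union>i\<in>insert j I. arcs (S i))"
    by (auto simp: contract_def E)
  have tail_in': "tail (contract G' T (w j)) e = w i"
    if "i \<in> insert j I" "tail G e \<in> verts (S i)" for i e
  proof (cases "i \<in> I")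
    case True
    then show ?thesis using that tail_in w_notin by (simp add: contract_def)
  next
    case False
    then have "tail G' e = tail G e" using that disj by (intro tail_out) auto
    then show ?thesis using that False by (simp add: contract_def)
  qed
  have head_in': "head (contract G' T (w j)) e = w i"
    if "i \<in> insert j I" "head G e \<in> verts (S i)" for i e
  proof (cases "i \<in> I")
    case True
    then show ?thesis using that head_in w_notin by (simp add: contract_def)
  next
    case False
    then have "head G' e = head G e" using that disj by (intro head_out) auto
    then show ?thesis using that False by (simp add: contract_def)
  qed
  have tail_out': "tail (contract G' T (w j)) e = tail G e"
    if "tail G e \<notin> (\<Union>i\<in>insert j I. verts (S i))" for e
    using that by (simp add: contract_def tail_out)
  have head_out': "head (contract G' T (w j)) e = head G e"
    if "head G e \<notin> (\<Union>i\<in>insert j I. verts (S i))" for e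
    using that by (simp add: contract_def head_out)
  show ?case
    by (intro exI[of _ "contract G' T (w j)"] conjI ballI allI impI)
      (fact step wf' V' E' | rule tail_in' head_in' tail_out' head_out'; assumption)+
qed

text \<open>
  The hypotheses say that \<open>S\<close> is a minor mapping from \<open>H\<close> to \<open>G\<close>. The injection \<open>\<alpha>\<close> chooses for every
  edge of \<open>H\<close> its own edge of \<open>G\<close>, which amounts to having enough edges between any two branch sets.
  The subdigraph to be contracted consists of the branch sets and the chosen edges.
\<close>

lemma minor_of_if_minor_mapping:
  fixes G :: "('a, 'b) pre_digraph" and H :: "('c, 'd) pre_digraph"
  assumes "wf_digraph G" "wf_digraph H" "finite (verts H)"
    and sub: "\<And>v. v \<in> verts H \<Longrightarrow> subgraph (S v) G"
    and sc: "\<And>v. v \<in> verts H \<Longrightarrow> strongly_connected (S v)"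
    and disj: "\<And>u v. u \<in> verts H \<Longrightarrow> v \<in> verts H \<Longrightarrow> u \<noteq> v \<Longrightarrow> verts (S u) \<inter> verts (S v) = {}"
    and inj: "inj_on \<alpha> (arcs H)"
    and arc: "\<And>e. e \<in> arcs H \<Longrightarrow> \<alpha> e \<in> arcs G"
    and tl: "\<And>e. e \<in> arcs H \<Longrightarrow> tail G (\<alpha> e) \<in> verts (S (tail H e))"
    and hd: "\<And>e. e \<in> arcs H \<Longrightarrow> head G (\<alpha> e) \<in> verts (S (head H e))"
    and new: "\<And>e v. e \<in> arcs H \<Longrightarrow> v \<in> verts H \<Longrightarrow> \<alpha> e \<notin> arcs (S v)"
  shows "minor_of H G"
proof -
  interpret G: wf_digraph G by fact
  interpret H: wf_digraph H by fact
  define G\<^sub>0 where "G\<^sub>0 = \<lparr>verts = \<Union>v\<in>verts H. verts (S v),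
    arcs = (\<Union>v\<in>verts H. arcs (S v)) \<union> \<alpha> ` arcs H, tail = tail G, head = head G\<rparr>"
  have G0_simps [simp]: "verts G\<^sub>0 = (\<Union>v\<in>verts H. verts (S v))"
    "arcs G\<^sub>0 = (\<Union>v\<in>verts H. arcs (S v)) \<union> \<alpha> ` arcs H" "tail G\<^sub>0 = tail G" "head G\<^sub>0 = head G"
    by (simp_all add: G\<^sub>0_def)
  have S_ends: "tail G e \<in> verts (S v)" "head G e \<in> verts (S v)"
    if "v \<in> verts H" "e \<in> arcs (S v)" for v e
    using sub[OF that(1)] that(2)
    by (auto simp: subgraph_def compatible_def dest: wf_digraph.wellformed)
  have wf0: "wf_digraph G\<^sub>0"
  proof unfold_locales
    fix e assume e: "e \<in> arcs G\<^sub>0"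
    show "tail G\<^sub>0 e \<in> verts G\<^sub>0"
      using e S_ends(1) tl H.tail_in_verts by fastforce
    show "head G\<^sub>0 e \<in> verts G\<^sub>0"
      using e S_ends(2) hd H.head_in_verts by fastforce
  qed
  have "subgraph G\<^sub>0 G"
    using sub arc wf0 \<open>wf_digraph G\<close>
    by (intro subgraphI) (auto simp: compatible_def subgraph_def)
  have sub0: "subgraph (S v) G\<^sub>0" if "v \<in> verts H" for v
    using sub[OF that] that wf0 by (auto simp: subgraph_def compatible_def)
  have "\<forall>v\<in>verts H. \<exists>x. x \<in> verts (S v)"
    using sc unfolding strongly_connected_def by blast
  then obtain w where w: "\<And>v. v \<in> verts H \<Longrightarrow> w v \<in> verts (S v)"
    by metis
  have inj_w: "inj_on w (verts H)"
    using w disj by (intro inj_onI) (metis disjoint_iff)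
  obtain G\<^sub>1 where steps: "contraction_step\<^sup>*\<^sup>* G\<^sub>0 G\<^sub>1" and wf1: "wf_digraph G\<^sub>1"
    and V: "verts G\<^sub>1 = w ` verts H \<union> (verts G\<^sub>0 - (\<Union>v\<in>verts H. verts (S v)))"
    and E: "arcs G\<^sub>1 = arcs G\<^sub>0 - (\<Union>v\<in>verts H. arcs (S v))"
    and tail1: "\<And>v e. v \<in> verts H \<Longrightarrow> tail G\<^sub>0 e \<in> verts (S v) \<Longrightarrow> tail G\<^sub>1 e = w v"
    and head1: "\<And>v e. v \<in> verts H \<Longrightarrow> head G\<^sub>0 e \<in> verts (S v) \<Longrightarrow> head G\<^sub>1 e = w v"
    using contract_disjoint_family[of "verts H" G\<^sub>0 S w, OF assms(3) wf0 sub0 sc w disj, simplified]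
    by (elim exE conjE) (rule that, assumption, simp_all)
  have V1: "verts G\<^sub>1 = w ` verts H" using V by auto
  have E1: "arcs G\<^sub>1 = \<alpha> ` arcs H" using E new by auto
  define f where "f = \<lparr>iso_verts = the_inv_into (verts H) w,
    iso_arcs = the_inv_into (arcs H) \<alpha>, iso_head = head H, iso_tail = tail H\<rparr>"
  have "pre_digraph.digraph_isomorphism G\<^sub>1 f"
    unfolding pre_digraph.digraph_isomorphism_def
  proof (intro conjI ballI)
    show "inj_on (iso_verts f) (verts G\<^sub>1)" "inj_on (iso_arcs f) (arcs G\<^sub>1)"
      using inj_w inj by (simp_all add: f_def V1 E1 inj_on_the_inv_into)
  next
    fix e' assume "e' \<in> arcs G\<^sub>1"
    then obtain e where e: "e \<in> arcs H" "e' = \<alpha> e" by (auto simp: E1)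
    show "iso_verts f (tail G\<^sub>1 e') = iso_tail f (iso_arcs f e')"
      using e tl tail1[of "tail H e" e'] inj inj_w
      by (simp add: f_def the_inv_into_f_f)
    show "iso_verts f (head G\<^sub>1 e') = iso_head f (iso_arcs f e')"
      using e hd head1[of "head H e" e'] inj inj_w
      by (simp add: f_def the_inv_into_f_f)
  qed (rule wf1)
  moreover have "H = app_iso f G\<^sub>1"
    using inj inj_w by (simp add: app_iso_def f_def V1 E1)
  ultimately have "digraph_iso G\<^sub>1 H" unfolding digraph_iso_def by blast
  with \<open>subgraph G\<^sub>0 G\<close> steps show ?thesis unfolding minor_of_def by blast
qed

section \<open>The minor in a triple\<close>

lemma strongly_connected_triangle:
  assumes "wf_digraph T" and "verts T = {x, y, z}"
    and "x \<rightarrow>\<^bsub>T\<^esub> y" "y \<rightarrow>\<^bsub>T\<^esub> z" "z \<rightarrow>\<^bsub>T\<^esub> x"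
  shows "strongly_connected T"
proof -
  interpret wf_digraph T by fact
  have r: "x \<rightarrow>\<^sup>*\<^bsub>T\<^esub> y" "y \<rightarrow>\<^sup>*\<^bsub>T\<^esub> z" "z \<rightarrow>\<^sup>*\<^bsub>T\<^esub> x"
    using assms(3-) by auto
  note r' = r reachable_trans[OF r(1,2)] reachable_trans[OF r(2,3)] reachable_trans[OF r(3,1)]
  show ?thesis
    unfolding strongly_connected_def assms(2) using r' assms(2) by auto
qed

theorem mainTheorem3:
  fixes G :: "('a, 'b) pre_digraph"
    and H :: "('c, 'd) pre_digraph"
    and A B C :: "'a set"
    and k :: nat
  assumes "fin_digraph G"
    and "k_triple G k A B C"
    and "semi_complete H"
    and "card (verts H) = k"
  shows "minor_of H G"
proof -
  interpret G: fin_digraph G by fact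
  interpret H: digraph H using assms(3) by (simp add: semi_complete_def)
  from assms(2) have AB: "A \<inter> B = {}" and AC: "A \<inter> C = {}" and BC: "B \<inter> C = {}"
    and card_B: "card B = k" and ABC: "A \<subseteq> verts G" "B \<subseteq> verts G" "C \<subseteq> verts G"
    and adj_AB: "\<And>x y. x \<in> A \<Longrightarrow> y \<in> B \<Longrightarrow> x \<rightarrow>\<^bsub>G\<^esub> y"
    and adj_BC: "\<And>x y. x \<in> B \<Longrightarrow> y \<in> C \<Longrightarrow> x \<rightarrow>\<^bsub>G\<^esub> y"
    by (auto simp: k_triple_def)
  from assms(2) obtain a' c' where a': "bij_betw a' {1..k} A" and c': "bij_betw c' {1..k} C"
    and ca: "\<And>i. i \<in> {1..k} \<Longrightarrow> c' i \<rightarrow>\<^bsub>G\<^esub> a' i"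
    unfolding k_triple_def by blast
  have "finite B" using ABC(2) G.finite_verts finite_subset by blast
  then obtain b where b: "bij_betw b (verts H) B"
    using finite_same_card_bij[of "verts H" B] card_B assms(4) by auto
  obtain h where h: "bij_betw h (verts H) {1..k}"
    using finite_same_card_bij[of "verts H" "{1..k}"] assms(4) by auto
  define a where "a = a' \<circ> h"
  define c where "c = c' \<circ> h"
  have a: "bij_betw a (verts H) A" and c: "bij_betw c (verts H) C"
    unfolding a_def c_def using h a' c' by (auto intro: bij_betw_trans)
  have mem: "a v \<in> A" "b v \<in> B" "c v \<in> C" if "v \<in> verts H" for v
    using that a b c by (auto simp: bij_betw_def)
  have inj: "a u = a v \<longleftrightarrow> u = v" "b u = b v \<longleftrightarrow> u = v" "c u = c v \<longleftrightarrow> u = v"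
    if "u \<in> verts H" "v \<in> verts H" for u v
    using that a b c by (auto simp: bij_betw_def inj_on_eq_iff)
  have ne: "a u \<noteq> b v" "a u \<noteq> c v" "b u \<noteq> c v" if "u \<in> verts H" "v \<in> verts H" for u v
    using mem[OF that(1)] mem[OF that(2)] AB AC BC by auto
  have adj_ca: "c v \<rightarrow>\<^bsub>G\<^esub> a v" if "v \<in> verts H" for v
    using ca[OF bij_betwE[OF h, rule_format, OF that]] by (simp add: a_def c_def)
  \<comment> \<open>Parallel edges are possible in \<open>G\<close>, so one edge is fixed for each ordered pair of ends.\<close>
  define \<epsilon> where "\<epsilon> x y = (SOME e. e \<in> arcs G \<and> tail G e = x \<and> head G e = y)" for x y
  have \<epsilon>: "\<epsilon> x y \<in> arcs G" "tail G (\<epsilon> x y) = x" "head G (\<epsilon> x y) = y" if "x \<rightarrow>\<^bsub>G\<^esub> y" for x y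
  proof -
    from that have "\<exists>e. e \<in> arcs G \<and> tail G e = x \<and> head G e = y" by blast
    from someI_ex[OF this] show "\<epsilon> x y \<in> arcs G" "tail G (\<epsilon> x y) = x" "head G (\<epsilon> x y) = y"
      unfolding \<epsilon>_def by blast+
  qed
  have adj: "a u \<rightarrow>\<^bsub>G\<^esub> b v" "b u \<rightarrow>\<^bsub>G\<^esub> c v" if "u \<in> verts H" "v \<in> verts H" for u v
    using that mem adj_AB adj_BC by auto
  define S where "S v = \<lparr>verts = {a v, b v, c v},
    arcs = {\<epsilon> (a v) (b v), \<epsilon> (b v) (c v), \<epsilon> (c v) (a v)}, tail = tail G, head = head G\<rparr>" for v
  define \<alpha> where "\<alpha> e = \<epsilon> (a (tail H e)) (b (head H e))" for e
  have S_simps [simp]: "verts (S v) = {a v, b v, c v}"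
    "arcs (S v) = {\<epsilon> (a v) (b v), \<epsilon> (b v) (c v), \<epsilon> (c v) (a v)}"
    "tail (S v) = tail G" "head (S v) = head G" for v
    by (simp_all add: S_def)
  have wf_S: "wf_digraph (S v)" if "v \<in> verts H" for v
    by unfold_locales (use that adj adj_ca \<epsilon> in auto)
  have \<alpha>: "\<alpha> e \<in> arcs G" "tail G (\<alpha> e) = a (tail H e)" "head G (\<alpha> e) = b (head H e)"
    if "e \<in> arcs H" for e
    unfolding \<alpha>_def using that adj(1)[of "tail H e" "head H e"] \<epsilon> by auto
  show ?thesis
  proof (rule minor_of_if_minor_mapping[of G H S \<alpha>])
    fix v assume v: "v \<in> verts H"
    show "subgraph (S v) G"
      using v ABC mem[OF v] adj adj_ca \<epsilon>(1) wf_S[OF v]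
      by (intro subgraphI) (auto simp: compatible_def G.wf_digraph)
    have "a v \<rightarrow>\<^bsub>S v\<^esub> b v" "b v \<rightarrow>\<^bsub>S v\<^esub> c v" "c v \<rightarrow>\<^bsub>S v\<^esub> a v"
      using v adj adj_ca \<epsilon>(2,3) by (auto simp: arcs_ends_conv)
    with wf_S[OF v] show "strongly_connected (S v)"
      by (intro strongly_connected_triangle[of "S v" "a v" "b v" "c v"]) auto
  next
    fix u v assume uv: "u \<in> verts H" "v \<in> verts H" "u \<noteq> v"
    have "{a u, b u, c u} \<inter> {a v, b v, c v} = {}"
      using uv inj[OF uv(1,2)] ne[OF uv(1,2)] ne[OF uv(2,1)] by auto
    then show "verts (S u) \<inter> verts (S v) = {}" by simp
  next
    show "inj_on \<alpha> (arcs H)"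
    proof (rule inj_onI)
      fix e e' assume e: "e \<in> arcs H" "e' \<in> arcs H" "\<alpha> e = \<alpha> e'"
      then have "a (tail H e) = a (tail H e')" "b (head H e) = b (head H e')"
        using \<alpha>(2,3) by metis+
      then have "arc_to_ends H e = arc_to_ends H e'"
        using e inj by (simp add: arc_to_ends_def)
      then show "e = e'" using e H.no_multi_arcs by blast
    qed
  next
    fix e v assume e: "e \<in> arcs H" and v: "v \<in> verts H"
    show "\<alpha> e \<notin> arcs (S v)"
    proof
      assume "\<alpha> e \<in> arcs (S v)"
      then consider "\<alpha> e = \<epsilon> (a v) (b v)" | "\<alpha> e = \<epsilon> (b v) (c v)" | "\<alpha> e = \<epsilon> (c v) (a v)"
        by auto
      then show False
      proof cases
        case 1
        then have "a (tail H e) = a v" "b (head H e) = b v"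
          using \<alpha>(2,3)[OF e] \<epsilon>(2,3) adj(1)[OF v v] by auto
        then have "tail H e = head H e" using e v inj by simp
        then show False using H.no_loops[OF e] by simp
      next
        case 2
        then have "a (tail H e) = b v" using \<alpha>(2)[OF e] \<epsilon>(2) adj(2)[OF v v] by auto
        then show False using ne(1) e v by simp
      next
        case 3
        then have "a (tail H e) = c v" using \<alpha>(2)[OF e] \<epsilon>(2) adj_ca[OF v] by auto
        then show False using ne(2) e v by simp
      qed
    qed
  qed (use \<alpha> in \<open>auto simp: G.wf_digraph H.wf_digraph\<close>)
qed

end
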